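(* Let $(i_n)_{n \geq 1} \in \{1,2,3\}^{\mathbb N}$ be a Brun-admissible sequence (i.e. $i_n=3$ for infinitely many $n$), let $P_0=U$ and let $P_n = \Sigma^{\mathsf{Br}}_{i_1} \cdots \Sigma^{\mathsf{Br}}_{i_n}(U)$ for $n \geq 1$. Then $(P_n)_{n\geq 0}$ is an increasing sequence of patterns contained in the discrete plane $\Gamma_{\mathbf v}$, where $\mathbf v \in \mathbb R^3_{>0}$ is the vector (unique up to positive scaling) whose Brun expansion is $(i_n)_{n \geq 1}$. Moreover, $\bigcup_{n\geq 0} P_n \subsetneq \Gamma_{\mathbf v}$ if and only if there exists $k$ such that $(i_n)_{n \geq k}$ is the labelling of an infinite backward path $\cdots \xrightarrow{i_{k+1}} \bullet \xrightarrow{i_k} \bullet$ in the labelled directed graph $\mathcal B$ with vertex set $\{p,q,r,s\}$ and edges $$p\xrightarrow{1}p,\quad p\xrightarrow{2}q,\quad q\xrightarrow{1}q,\quad q\xrightarrow{2}p,\quad q\xrightarrow{3}r,\quad r\xrightarrow{2}s,\quad r\xrightarrow{3}s,\quad s\xrightarrow{1}s,\quad s\xrightarrow{3}p,$$ with the edge $p\xrightarrow{2}q$ being the only edge labelled $2$ leaving $p$ and $q\xrightarrow{2}p$ the only edge labelled $2$ leaving $q$, and including the loop $q\xrightarrow{1}q$.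
   Context: Let $(\mathbf e_1,\mathbf e_2,\mathbf e_3)$ be the canonical basis of $\mathbb R^3$. For $\mathbf x\in\mathbb Z^3$ and $i\in\{1,2,3\}$, the face $[\mathbf x,i]^\star$ is the unit square $\{\mathbf x+\lambda\mathbf e_j+\mu\mathbf e_k:\lambda,\mu\in[0,1]\}$ where $\{i,j,k\}=\{1,2,3\}$. A pattern is a finite union of faces. Let $U=[\mathbf 0,1]^\star\cup[\mathbf 0,2]^\star\cup[\mathbf 0,3]^\star$. For $\mathbf v\in\mathbb R^3_{>0}$, the discrete plane $\Gamma_{\mathbf v}$ is the union of the faces $[\mathbf x,i]^\star$ with $0\le\langle\mathbf x,\mathbf v\rangle<\langle\mathbf e_i,\mathbf v\rangle$. Dual substitutions. For a substitution $\sigma$ on $\{1,2,3\}$, let $\mathbf P(w)=(|w|_1,|w|_2,|w|_3)$ be the abelianization of a word $w$, and $\mathbf M_\sigma$ the matrix whose $i$th column is $\mathbf P(\sigma(i))$. If $\det\mathbf M_\sigma=\pm1$, then $$\mathbf E_1^\star(\sigma)([\mathbf x,i]^\star)=\bigcup_{(p,j,s):\ \sigma(j)=pis}[\mathbf M_\sigma^{-1}(\mathbf x+\mathbf P(s)),j]^\star,$$ extended to unions of faces by taking unions. Products of dual substitutions denote compositions of maps. Brun substitutions: $\sigma^{\mathsf{Br}}_1:1\mapsto1,2\mapsto2,3\mapsto32$; $\sigma^{\mathsf{Br}}_2:1\mapsto1,2\mapsto3,3\mapsto23$; $\sigma^{\mathsf{Br}}_3:1\mapsto2,2\mapsto3,3\mapsto13$;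 $\Sigma^{\mathsf{Br}}_i=\mathbf E_1^\star(\sigma^{\mathsf{Br}}_i)$. Brun expansion. For $\mathbf v$ with $0\le\mathbf v_1\le\mathbf v_2\le\mathbf v_3$, the (additive, ordered) Brun map sends $\mathbf v$ to: $(\mathbf v_1,\mathbf v_2,\mathbf v_3-\mathbf v_2)$ if $\mathbf v_1\le\mathbf v_2\le\mathbf v_3-\mathbf v_2$ (branch $1$); $(\mathbf v_1,\mathbf v_3-\mathbf v_2,\mathbf v_2)$ if $\mathbf v_1\le\mathbf v_3-\mathbf v_2<\mathbf v_2$ (branch $2$); $(\mathbf v_3-\mathbf v_2,\mathbf v_1,\mathbf v_2)$ if $\mathbf v_3-\mathbf v_2<\mathbf v_1\le\mathbf v_2$ (branch $3$). The Brun expansion of $\mathbf v$ is the sequence $(i_n)_{n\ge1}$ of branches used when iterating this map from $\mathbf v$. Every sequence with infinitely many $3$s is the Brun expansion of a vector that is unique up to positive scaling. An infinite backward path labelled $(i_n)_{n\ge k}$ is a sequence of vertices $(w_n)_{n\ge k}$ such that for every $n\ge k$ there is an edge $w_{n+1}\xrightarrow{i_n}w_n$. *)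

theory Defs
  imports "HOL-Analysis.Analysis"
begin

section \<open>Faces, patterns and discrete planes\<close>

text \<open>Coordinates, letters and branch labels all range over the three-element type \<^typ>\<open>3\<close>,
  whose elements are written 1, 2, 3.\<close>

definition real_vec :: "int^3 \<Rightarrow> real^3" where
  "real_vec x = (\<chi> a. of_int (x $ a))"

definition face :: "int^3 \<Rightarrow> 3 \<Rightarrow> (real^3) set" where
  "face x i = {real_vec x + l *\<^sub>R axis j 1 + m *\<^sub>R axis k 1 | l m j k.
     l \<in> {0..1} \<and> m \<in> {0..1} \<and> {i, j, k} = {1, 2, 3}}"

definition pattern :: "(real^3) set \<Rightarrow> bool" where
  "pattern S \<longleftrightarrow> (\<exists>F. finite F \<and> S = (\<Union>(x, i)\<in>F. face x i))"

definition unit_pattern :: "(real^3) set" where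
  "unit_pattern = face 0 1 \<union> face 0 2 \<union> face 0 3"

definition discrete_plane :: "real^3 \<Rightarrow> (real^3) set" where
  "discrete_plane v =
     \<Union>{face x i | x i. 0 \<le> real_vec x \<bullet> v \<and> real_vec x \<bullet> v < axis i 1 \<bullet> v}"


section \<open>Dual substitutions\<close>

text \<open>A substitution is given by the images of the letters.\<close>

type_synonym substitution = "3 \<Rightarrow> 3 list"

definition abelianization :: "3 list \<Rightarrow> int^3" where
  "abelianization w = (\<chi> a. int (count_list w a))"

definition incidence_matrix :: "substitution \<Rightarrow> int^3^3" where
  "incidence_matrix \<sigma> = (\<chi> a b. abelianization (\<sigma> b) $ a)"

text \<open>Only meaningful if the incidence matrix has determinant 1 or -1; the inverse is then
  an integer matrix.\<close>

definition dual_subst_face :: "substitution \<Rightarrow> int^3 \<Rightarrow> 3 \<Rightarrow> (real^3) set" where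
  "dual_subst_face \<sigma> x i =
     \<Union>{face (matrix_inv (incidence_matrix \<sigma>) *v (x + abelianization s)) j | p j s.
         \<sigma> j = p @ [i] @ s}"

text \<open>The extension to unions of faces. The faces contained in a union of faces are exactly the
  members of that union, so this is the extension by unions; see \<open>dual_subst_Union_faces\<close> below.\<close>

definition dual_subst :: "substitution \<Rightarrow> (real^3) set \<Rightarrow> (real^3) set" where
  "dual_subst \<sigma> S = \<Union>{dual_subst_face \<sigma> x i | x i. face x i \<subseteq> S}"

lemma face_iff:
  "y \<in> face x i \<longleftrightarrow>
     (\<forall>a. real_of_int (x $ a) \<le> y $ a \<and> y $ a \<le> real_of_int (x $ a) + (if a = i then 0 else 1))"
  (is "?L \<longleftrightarrow> ?R")
proof
  assume ?L
  then obtain l m j k where h: "y = real_vec x + l *\<^sub>R axis j 1 + m *\<^sub>R axis k 1"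
    "l \<in> {0..1}" "m \<in> {0..1}" "{i, j, k} = {1, 2, 3}"
    unfolding face_def by auto
  have "(1::3) \<in> {i, j, k}" "(2::3) \<in> {i, j, k}" "(3::3) \<in> {i, j, k}"
    unfolding h(4) by auto
  hence "i \<noteq> j" "i \<noteq> k" "j \<noteq> k" by auto
  thus ?R using h(1-3) by (auto simp: real_vec_def axis_def)
next
  assume R: ?R
  have "\<exists>j k. {i, j, k} = {1, 2, 3} \<and> i \<noteq> j \<and> i \<noteq> k \<and> j \<noteq> k"
    using exhaust_3[of i]
  proof (elim disjE)
    assume "i = 1" thus ?thesis by (intro exI[of _ 2] exI[of _ 3]) auto
  next
    assume "i = 2" thus ?thesis by (intro exI[of _ 1] exI[of _ 3]) auto
  next
    assume "i = 3" thus ?thesis by (intro exI[of _ 1] exI[of _ 2]) auto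
  qed
  then obtain j k where jk: "{i, j, k} = {1, 2, 3}" "i \<noteq> j" "i \<noteq> k" "j \<noteq> k" by blast
  have all: "a = i \<or> a = j \<or> a = k" for a :: 3
  proof -
    have "a \<in> {1, 2, 3}" using exhaust_3[of a] by auto
    thus ?thesis unfolding jk(1)[symmetric] by auto
  qed
  have "y = real_vec x + (y $ j - x $ j) *\<^sub>R axis j 1 + (y $ k - x $ k) *\<^sub>R axis k 1"
  proof (unfold vec_eq_iff, intro allI)
    fix a :: 3
    have "y $ i = of_int (x $ i)" using R[rule_format, of i] by simp
    thus "y $ a = (real_vec x + (y $ j - x $ j) *\<^sub>R axis j 1
        + (y $ k - x $ k) *\<^sub>R axis k 1) $ a"
      using all[of a] jk(2-4) by (auto simp: real_vec_def axis_def)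
  qed
  moreover have "y $ j - x $ j \<in> {0..1}" "y $ k - x $ k \<in> {0..1}"
    using R[rule_format, of j] R[rule_format, of k] jk(2,3) by auto
  ultimately show ?L unfolding face_def using jk(1) by blast
qed

lemma face_subset_Union_faces_iff:
  "face x i \<subseteq> (\<Union>(y, j)\<in>F. face y j) \<longleftrightarrow> (x, i) \<in> F"
proof
  assume sub: "face x i \<subseteq> (\<Union>(y, j)\<in>F. face y j)"
  define c :: "real^3" where "c = (\<chi> a. of_int (x $ a) + (if a = i then 0 else 1/2))"
  have "c \<in> face x i" by (auto simp: face_iff c_def)
  then obtain y j where yj: "(y, j) \<in> F" "c \<in> face y j" using sub by blast
  have b: "real_of_int (y $ a) \<le> c $ a" "c $ a \<le> real_of_int (y $ a) + (if a = j then 0 else 1)" for a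
    using yj(2) unfolding face_iff by blast+
  have ij: "j = i"
  proof (rule ccontr)
    assume "j \<noteq> i"
    hence "real_of_int (x $ j) + 1/2 = real_of_int (y $ j)"
      using b[of j] by (auto simp: c_def)
    hence "real_of_int (2 * x $ j + 1) = real_of_int (2 * y $ j)" by simp
    hence "2 * x $ j + 1 = 2 * y $ j" by (simp only: of_int_eq_iff)
    thus False by presburger
  qed
  have "x $ a = y $ a" for a
  proof (cases "a = i")
    case True
    thus ?thesis using b[of a] ij by (auto simp: c_def)
  next
    case False
    thus ?thesis using b[of a] ij by (simp add: c_def)
  qed
  hence "x = y" by (simp add: vec_eq_iff)
  thus "(x, i) \<in> F" using yj(1) ij by simp
qed auto

lemma dual_subst_Union_faces:
  "dual_subst \<sigma> (\<Union>(x, i)\<in>F. face x i) = (\<Union>(x, i)\<in>F. dual_subst_face \<sigma> x i)"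
  unfolding dual_subst_def face_subset_Union_faces_iff by blast


section \<open>Brun substitutions and Brun expansions\<close>

definition brun_subst :: "3 \<Rightarrow> substitution" where
  "brun_subst i =
     (if i = 1 then (\<lambda>a. if a = 1 then [1] else if a = 2 then [2] else [3, 2])
      else if i = 2 then (\<lambda>a. if a = 1 then [1] else if a = 2 then [3] else [2, 3])
      else (\<lambda>a. if a = 1 then [2] else if a = 2 then [3] else [1, 3]))"

lemma det_incidence_matrix_brun_subst:
  "det (incidence_matrix (brun_subst i)) \<in> {1, - 1}"
  using exhaust_3[of i]
  by (auto simp: det_3 incidence_matrix_def abelianization_def brun_subst_def)

definition brun_dual :: "3 \<Rightarrow> (real^3) set \<Rightarrow> (real^3) set" where
  "brun_dual i = dual_subst (brun_subst i)"

text \<open>For a sequence \<open>i\<close> indexed from 1 (the value \<open>i 0\<close> is never used), the composition of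
  \<open>brun_dual (i 1)\<close>, ..., \<open>brun_dual (i n)\<close>, where \<open>brun_dual (i n)\<close> is applied first.\<close>

primrec brun_dual_prod :: "(nat \<Rightarrow> 3) \<Rightarrow> nat \<Rightarrow> (real^3) set \<Rightarrow> (real^3) set" where
  "brun_dual_prod i 0 = id"
| "brun_dual_prod i (Suc n) = brun_dual_prod i n \<circ> brun_dual (i (Suc n))"

definition brun_pattern :: "(nat \<Rightarrow> 3) \<Rightarrow> nat \<Rightarrow> (real^3) set" where
  "brun_pattern i n = brun_dual_prod i n unit_pattern"

definition brun_admissible :: "(nat \<Rightarrow> 3) \<Rightarrow> bool" where
  "brun_admissible i \<longleftrightarrow> infinite {n. n \<ge> 1 \<and> i n = 3}"

definition brun_ordered :: "real^3 \<Rightarrow> bool" where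
  "brun_ordered v \<longleftrightarrow> 0 \<le> v $ 1 \<and> v $ 1 \<le> v $ 2 \<and> v $ 2 \<le> v $ 3"

text \<open>On ordered vectors, the last case is \<open>v $ 3 - v $ 2 < v $ 1 \<and> v $ 1 \<le> v $ 2\<close>. The Brun map
  sends ordered vectors to ordered vectors.\<close>

definition brun_branch :: "real^3 \<Rightarrow> 3" where
  "brun_branch v =
     (if v $ 1 \<le> v $ 2 \<and> v $ 2 \<le> v $ 3 - v $ 2 then 1
      else if v $ 1 \<le> v $ 3 - v $ 2 \<and> v $ 3 - v $ 2 < v $ 2 then 2
      else 3)"

definition brun_map :: "real^3 \<Rightarrow> real^3" where
  "brun_map v =
     (if brun_branch v = 1 then vector [v $ 1, v $ 2, v $ 3 - v $ 2]
      else if brun_branch v = 2 then vector [v $ 1, v $ 3 - v $ 2, v $ 2]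
      else vector [v $ 3 - v $ 2, v $ 1, v $ 2])"

definition has_brun_expansion :: "real^3 \<Rightarrow> (nat \<Rightarrow> 3) \<Rightarrow> bool" where
  "has_brun_expansion v i \<longleftrightarrow>
     brun_ordered v \<and> (\<forall>n\<ge>1. i n = brun_branch ((brun_map ^^ (n - 1)) v))"


section \<open>The labelled graph\<close>

datatype brun_vertex = Vp | Vq | Vr | Vs

definition brun_graph :: "(brun_vertex \<times> 3 \<times> brun_vertex) set" where
  "brun_graph =
     {(Vp, 1, Vp), (Vp, 2, Vq), (Vq, 1, Vq), (Vq, 2, Vp), (Vq, 3, Vr),
      (Vr, 2, Vs), (Vr, 3, Vs), (Vs, 1, Vs), (Vs, 3, Vp)}"

definition backward_path_labelling :: "(nat \<Rightarrow> 3) \<Rightarrow> nat \<Rightarrow> bool" where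
  "backward_path_labelling i k \<longleftrightarrow>
     (\<exists>w :: nat \<Rightarrow> brun_vertex. \<forall>n\<ge>k. (w (n + 1), i n, w n) \<in> brun_graph)"

end

(* Inside discrete planes every face of Gamma_v has exactly one parent, the face of Gamma_v' (v' the
   image of v under the Brun map) whose dual image contains it, and a face lies in P_n iff its n-th
   ancestor lies in U. The key fact is that two faces of a plane whose base points are at sup-distance
   at most 1 have parents with the same property. Given a face that is never absorbed in U, take one
   with base point of minimal 1-norm: some neighbour closer to the origin is absorbed, so the
   ancestors eventually have base points in {-1,0,1}^3. Only 12 nonzero such base points occur, and
   along parents a rank on them never increases; since label 3 strictly lowers the rank of every base
   point outside four special ones, the ancestry is finally confined to these four, on which the
   parent relation follows the reversed graph B. Conversely a backward path in B lifts to a sequence of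
   faces, each the parent of the preceding one. Those above p and q lie in every discrete plane, and
   the path visits p or q infinitely often, so all faces of the sequence lie in the planes. *)
theory Submission
  imports Defs
begin

section \<open>Sets of faces and their dual images\<close>

type_synonym face_index = "(int^3) \<times> 3"

definition faces_union :: "face_index set \<Rightarrow> (real^3) set" where
  "faces_union F = (\<Union>(x, i)\<in>F. face x i)"

definition plane_faces :: "real^3 \<Rightarrow> face_index set" where
  "plane_faces v = {(x, i). 0 \<le> real_vec x \<bullet> v \<and> real_vec x \<bullet> v < v $ i}"

definition unit_faces :: "face_index set" where
  "unit_faces = {0} \<times> UNIV"

text \<open>Membership of \<open>g\<close> in the dual image of \<open>f\<close>, with the equation
  multiplied by the incidence matrix so that no inverse occurs.\<close>

definition parent :: "3 \<Rightarrow> face_index \<Rightarrow> face_index \<Rightarrow> bool" where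
  "parent b g f \<longleftrightarrow> (\<exists>p s. brun_subst b (snd g) = p @ [snd f] @ s \<and>
     fst f = incidence_matrix (brun_subst b) *v fst g - abelianization s)"

definition dual_faces :: "3 \<Rightarrow> face_index set \<Rightarrow> face_index set" where
  "dual_faces b F = {g. \<exists>f\<in>F. parent b g f}"

text \<open>A face inside a union of faces is a member of that union, so inclusions of point sets
  may be replaced by inclusions of index sets.\<close>

lemma faces_union_subset_iff: "faces_union F \<subseteq> faces_union G \<longleftrightarrow> F \<subseteq> G"
proof
  assume sub: "faces_union F \<subseteq> faces_union G"
  show "F \<subseteq> G"
  proof
    fix f assume "f \<in> F"
    then have "face (fst f) (snd f) \<subseteq> faces_union G"
      using sub by (force simp: faces_union_def)
    then show "f \<in> G"
      unfolding faces_union_def face_subset_Union_faces_iff by simp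
  qed
qed (auto simp: faces_union_def)

lemma discrete_plane_eq: "discrete_plane v = faces_union (plane_faces v)"
  by (auto simp: discrete_plane_def faces_union_def plane_faces_def inner_axis_axis inner_axis')

lemma unit_pattern_eq: "unit_pattern = faces_union unit_faces"
  unfolding unit_pattern_def faces_union_def unit_faces_def
  by (auto simp: UNIV_3)

lemma matrix_vector_mult_inverse_iff:
  fixes A B :: "'a::comm_ring_1^'n^'n"
  assumes "A ** B = mat 1" "B ** A = mat 1"
  shows "matrix_inv A *v x = y \<longleftrightarrow> x = A *v y"
proof -
  have inv: "invertible A" using assms by (auto simp: invertible_def)
  have "A ** matrix_inv A = mat 1 \<and> matrix_inv A ** A = mat 1"
    \<comment> \<open>\<open>matrix_inv\<close> is a choice among two-sided inverses;
      \<open>B\<close> shows that there is one.\<close>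
    unfolding matrix_inv_def by (rule someI[of _ B]) (use assms in simp)
  then show ?thesis
    by (metis matrix_vector_mul_assoc matrix_vector_mul_lid)
qed

lemma incidence_matrix_brun_subst_inverse:
  "\<exists>B. incidence_matrix (brun_subst b) ** B = mat 1 \<and> B ** incidence_matrix (brun_subst b) = mat 1"
proof -
  consider "b = 1" | "b = 2" | "b = 3" using exhaust_3 by blast
  then show ?thesis
  proof cases
    case 1
    show ?thesis
      by (rule exI[of _ "vector [vector [1, 0, 0], vector [0, 1, -1], vector [0, 0, 1]]"])
        (auto simp: 1 vec_eq_iff forall_3 matrix_matrix_mult_def sum_3 mat_def incidence_matrix_def
          abelianization_def brun_subst_def)
  next
    case 2
    show ?thesis
      by (rule exI[of _ "vector [vector [1, 0, 0], vector [0, -1, 1], vector [0, 1, 0]]"])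
        (auto simp: 2 vec_eq_iff forall_3 matrix_matrix_mult_def sum_3 mat_def incidence_matrix_def
          abelianization_def brun_subst_def)
  next
    case 3
    show ?thesis
      by (rule exI[of _ "vector [vector [0, 1, 0], vector [-1, 0, 1], vector [1, 0, 0]]"])
        (auto simp: 3 vec_eq_iff forall_3 matrix_matrix_mult_def sum_3 mat_def incidence_matrix_def
          abelianization_def brun_subst_def)
  qed
qed

lemma brun_dual_faces_union: "brun_dual b (faces_union F) = faces_union (dual_faces b F)"
proof -
  obtain B where B: "incidence_matrix (brun_subst b) ** B = mat 1"
      "B ** incidence_matrix (brun_subst b) = mat 1"
    using incidence_matrix_brun_subst_inverse by blast
  have "x = incidence_matrix (brun_subst b) *v y - w \<longleftrightarrow>
      y = matrix_inv (incidence_matrix (brun_subst b)) *v (x + w)" for x y w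
    using matrix_vector_mult_inverse_iff[OF B, of "x + w" y] by (auto simp: algebra_simps)
  then have parent_iff: "parent b (y, j) (x, i) \<longleftrightarrow> (\<exists>p s. brun_subst b j = p @ [i] @ s \<and>
      y = matrix_inv (incidence_matrix (brun_subst b)) *v (x + abelianization s))" for x y i j
    by (simp add: parent_def)
  have "dual_subst_face (brun_subst b) x i = (\<Union>(y, j)\<in>{g. parent b g (x, i)}. face y j)" for x i
    unfolding dual_subst_face_def by (auto simp: parent_iff) blast+
  then have "brun_dual b (faces_union F) = (\<Union>(x, i)\<in>F. \<Union>(y, j)\<in>{g. parent b g (x, i)}. face y j)"
    by (simp only: brun_dual_def faces_union_def dual_subst_Union_faces)
  then show ?thesis
    by (fastforce simp: faces_union_def dual_faces_def)
qed

lemma singleton_eq_append_iff: "[a] = p @ [c] @ s \<longleftrightarrow> p = [] \<and> a = c \<and> s = []"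
  by (auto simp: Cons_eq_append_conv)

lemma pair_eq_append_iff:
  "[a, b] = p @ [c] @ s \<longleftrightarrow> p = [] \<and> a = c \<and> s = [b] \<or> p = [a] \<and> b = c \<and> s = []"
  by (auto simp: Cons_eq_append_conv)

text \<open>If the substitution maps \<open>j\<close> to two letters, which happens only for \<open>j = 3\<close>, the flag
  \<open>hi\<close> selects the first of them, whose suffix is nonempty.\<close>

definition parent_at :: "3 \<Rightarrow> bool \<Rightarrow> face_index \<Rightarrow> face_index" where
  "parent_at b hi g = (case g of (y, j) \<Rightarrow>
     let m = y $ 2 + y $ 3 - of_bool hi in
     if b = 1 then (vector [y $ 1, m, y $ 3], if hi then 3 else if j = 1 then 1 else 2)
     else if b = 2 then (vector [y $ 1, y $ 3, m], if hi then 2 else if j = 1 then 1 else 3)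
     else (vector [y $ 3, y $ 1, m], if hi then 1 else if j = 1 then 2 else 3))"

text \<open>For each label the product of the matrix with \<open>y\<close> has entries
  \<open>y $ 1\<close>, \<open>y $ 3\<close> and \<open>y $ 2 + y $ 3\<close>, and the nonempty
  suffix subtracts 1 from the last of these.\<close>

lemma parent_iff: "parent b g f \<longleftrightarrow> f = parent_at b False g \<or> snd g = 3 \<and> f = parent_at b True g"
proof -
  obtain y j x i where gf: "g = (y, j)" "f = (x, i)" by fastforce
  have "parent b (y, j) (x, i) \<longleftrightarrow> (x, i) = parent_at b False (y, j) \<or> j = 3 \<and> (x, i) = parent_at b True (y, j)"
    using exhaust_3[of j] exhaust_3[of b]
    \<comment> \<open>Deleting \<open>append.simps\<close> preserves the form
      \<open>p @ [i] @ s\<close> on which the two splitting lemmas match.\<close>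
    by (auto simp: parent_def parent_at_def Let_def brun_subst_def singleton_eq_append_iff
        pair_eq_append_iff vec_eq_iff[of x] forall_3 incidence_matrix_def matrix_vector_mult_def sum_3
        abelianization_def simp del: append.simps)
  then show ?thesis by (simp add: gf)
qed

section \<open>Parents inside discrete planes\<close>

text \<open>The strict inequality makes \<open>v $ 3 - v $ 2\<close>, a coordinate of the image
  under the Brun map, positive.\<close>

definition brun_pos :: "real^3 \<Rightarrow> bool" where
  "brun_pos v \<longleftrightarrow> 0 < v $ 1 \<and> v $ 1 \<le> v $ 2 \<and> v $ 2 < v $ 3"

lemma real_vec_inner: "real_vec x \<bullet> v = x $ 1 * v $ 1 + x $ 2 * v $ 2 + x $ 3 * v $ 3"
  by (simp add: real_vec_def inner_vec_def sum_3)

lemma brun_map_cases: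
  fixes v :: "real^3"
  obtains "brun_branch v = 1" "brun_map v = vector [v $ 1, v $ 2, v $ 3 - v $ 2]"
  | "brun_branch v = 2" "brun_map v = vector [v $ 1, v $ 3 - v $ 2, v $ 2]"
  | "brun_branch v = 3" "brun_map v = vector [v $ 3 - v $ 2, v $ 1, v $ 2]"
  using exhaust_3[of "brun_branch v"] by (auto simp: brun_map_def)

text \<open>The transposed incidence matrix maps \<open>brun_map v\<close> to \<open>v\<close>, so
  heights are preserved; the suffix letter has height \<open>v $ 2\<close>.\<close>

lemma parent_at_inner:
  "real_vec (fst (parent_at (brun_branch v) hi (y, j))) \<bullet> brun_map v =
     real_vec y \<bullet> v - of_bool hi * v $ 2"
  by (rule brun_map_cases[of v]) (auto simp: parent_at_def Let_def real_vec_inner algebra_simps)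

lemma brun_map_parent_at:
  "brun_map v $ snd (parent_at (brun_branch v) hi (y, j)) =
     (if hi then v $ 3 - v $ 2 else if j = 3 then v $ 2 else v $ j)"
  using exhaust_3[of j]
  by (rule_tac brun_map_cases[of v]) (auto simp: parent_at_def Let_def)

text \<open>For type 3 the window of heights from 0 to \<open>v $ 3\<close> is cut at
  \<open>v $ 2\<close> into the windows of the two candidates, hence exactly one parent lies in the
  next plane.\<close>

lemma parent_at_plane_iff:
  "parent_at (brun_branch v) hi (y, j) \<in> plane_faces (brun_map v) \<longleftrightarrow>
    (if hi then v $ 2 \<le> real_vec y \<bullet> v \<and> real_vec y \<bullet> v < v $ 3
     else 0 \<le> real_vec y \<bullet> v \<and> real_vec y \<bullet> v < (if j = 3 then v $ 2 else v $ j))"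
  using parent_at_inner[of v hi y j] brun_map_parent_at[of v hi y j]
  by (auto simp: plane_faces_def split: prod.splits)

lemma parent_in_plane:
  assumes "brun_pos v" "parent (brun_branch v) g f" "f \<in> plane_faces (brun_map v)"
  shows "g \<in> plane_faces v"
  using assms by (cases g)
    (auto simp: parent_iff parent_at_plane_iff plane_faces_def[of v] brun_pos_def split: if_splits)

text \<open>In the plane of an ordered \<open>v\<close>, faces of type 1 or 2 have height below
  \<open>v $ 2\<close>, so the flag is set for type 3 only.\<close>

definition parent_face :: "real^3 \<Rightarrow> face_index \<Rightarrow> face_index" where
  "parent_face v g = parent_at (brun_branch v) (v $ 2 \<le> real_vec (fst g) \<bullet> v) g"

lemma parent_face_iff:
  assumes "brun_pos v" "g \<in> plane_faces v"
  shows "parent (brun_branch v) g f \<and> f \<in> plane_faces (brun_map v) \<longleftrightarrow> f = parent_face v g"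
  using assms exhaust_3[of "snd g"]
  by (cases g; cases "v $ 2 \<le> real_vec (fst g) \<bullet> v")
    (auto simp: parent_iff parent_at_plane_iff parent_face_def plane_faces_def[of v] brun_pos_def)

text \<open>Two coordinates are copied, and the third changes the difference to
  \<open>d2 + d3 - e + e'\<close>. If \<open>d2 + d3 = 2\<close>, the heights differ by at least
  \<open>v $ 3\<close>, which is impossible. If \<open>d2 + d3 = 1\<close>, then \<open>y\<close> is
  at least as high as \<open>y'\<close>, which excludes \<open>e = 0\<close> with
  \<open>e' = 1\<close>. The negative cases are symmetric.\<close>

lemma parent_face_close:
  assumes "brun_pos v" "g \<in> plane_faces v" "g' \<in> plane_faces v"
    and close: "\<And>a. \<bar>fst g $ a - fst g' $ a\<bar> \<le> 1"
  shows "\<bar>fst (parent_face v g) $ a - fst (parent_face v g') $ a\<bar> \<le> 1"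
proof -
  obtain y j y' j' where gg': "g = (y, j)" "g' = (y', j')" by fastforce
  define e where "e = (of_bool (v $ 2 \<le> real_vec y \<bullet> v) :: int)"
  define e' where "e' = (of_bool (v $ 2 \<le> real_vec y' \<bullet> v) :: int)"
  define d2 d3 where d: "d2 = y $ 2 - y' $ 2" "d3 = y $ 3 - y' $ 3"
  have close': "\<bar>y $ a - y' $ a\<bar> \<le> 1" for a using close[of a] by (simp add: gg')
  have "\<bar>d2 + d3 - e + e'\<bar> \<le> 1"
  proof -
    define d1 where "d1 = y $ 1 - y' $ 1"
    have "d1 = -1 \<or> d1 = 0 \<or> d1 = 1" "d2 = -1 \<or> d2 = 0 \<or> d2 = 1" "d3 = -1 \<or> d3 = 0 \<or> d3 = 1"
      using close'[of 1] close'[of 2] close'[of 3] by (auto simp: d d1_def)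
    moreover have "real_vec y \<bullet> v - real_vec y' \<bullet> v = d1 * v $ 1 + d2 * v $ 2 + d3 * v $ 3"
      by (simp add: real_vec_inner d d1_def algebra_simps)
    moreover have "v $ j \<le> v $ 3" "v $ j' \<le> v $ 3"
      using exhaust_3[of j] exhaust_3[of j'] assms(1) by (auto simp: brun_pos_def)
    then have "0 \<le> real_vec y \<bullet> v" "real_vec y \<bullet> v < v $ 3" "0 \<le> real_vec y' \<bullet> v" "real_vec y' \<bullet> v < v $ 3"
      using assms(2,3) by (auto simp: gg' plane_faces_def)
    moreover have "e = 0 \<and> real_vec y \<bullet> v < v $ 2 \<or> e = 1 \<and> v $ 2 \<le> real_vec y \<bullet> v"
      "e' = 0 \<and> real_vec y' \<bullet> v < v $ 2 \<or> e' = 1 \<and> v $ 2 \<le> real_vec y' \<bullet> v"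
      by (auto simp: e_def e'_def)
    moreover have "0 < v $ 1" "v $ 1 \<le> v $ 2" "v $ 2 < v $ 3"
      using assms(1) by (auto simp: brun_pos_def)
    ultimately show ?thesis
      by (elim disjE conjE; simp)
  qed
  moreover have "fst (parent_face v g) $ a - fst (parent_face v g') $ a
      \<in> {y $ 1 - y' $ 1, y $ 3 - y' $ 3, d2 + d3 - e + e'}"
    using exhaust_3[of a]
    by (auto simp: gg' parent_face_def parent_at_def Let_def d e_def e'_def)
  ultimately show ?thesis
    using close'[of 1] close'[of 3] by auto
qed

section \<open>Base points near the origin\<close>

text \<open>Triples can be compared with literal values by rewriting.\<close>

definition coords :: "int^3 \<Rightarrow> int \<times> int \<times> int" where
  "coords x = (x $ 1, x $ 2, x $ 3)"

text \<open>Only meaningful for the four base points of rank 3 below; all others are sent to \<open>Vs\<close>.\<close>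

definition core_vertex :: "int^3 \<Rightarrow> brun_vertex" where
  "core_vertex x = (if coords x = (-1, 0, 1) then Vp else if coords x = (-1, 1, 0) then Vq
     else if coords x = (1, 1, -1) then Vr else Vs)"

text \<open>A potential for the parent relation on the points listed in
  \<open>small_plane_face\<close>; rank 3 singles out the four points that carry the vertices of the
  graph.\<close>

definition face_rank :: "int^3 \<Rightarrow> nat" where
  "face_rank x = (if coords x = (-1, -1, 1) then 4
     else if coords x \<in> {(-1, 0, 1), (-1, 1, 0), (1, 1, -1), (1, -1, 1)} then 3
     else if coords x = (0, -1, 1) then 2
     else if coords x \<in> {(1, -1, 0), (1, 0, 0), (1, 1, 0)} then 1 else 0)"

lemma small_plane_face:
  assumes v: "brun_pos v" and g: "g \<in> plane_faces v"
    and small: "\<And>a. \<bar>fst g $ a\<bar> \<le> 1" and nz: "fst g \<noteq> 0"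
  shows "coords (fst g) \<in> {(-1, -1, 1), (-1, 0, 1), (-1, 1, 0), (0, -1, 1),
     (0, 1, -1), (0, 1, 0), (1, -1, 0), (1, -1, 1), (1, 0, -1),
     (1, 0, 0), (1, 1, -1), (1, 1, 0)}"
proof -
  obtain x i where gx: "g = (x, i)" by fastforce
  have "x $ a = -1 \<or> x $ a = 0 \<or> x $ a = 1" for a
    using small[of a] by (auto simp: gx abs_le_iff)
  then have cases: "x $ 1 = -1 \<or> x $ 1 = 0 \<or> x $ 1 = 1" "x $ 2 = -1 \<or> x $ 2 = 0 \<or> x $ 2 = 1"
    "x $ 3 = -1 \<or> x $ 3 = 0 \<or> x $ 3 = 1"
    by blast+
  have "v $ i \<le> v $ 3"
    using exhaust_3[of i] v by (auto simp: brun_pos_def)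
  then have "0 \<le> x $ 1 * v $ 1 + x $ 2 * v $ 2 + x $ 3 * v $ 3"
      "x $ 1 * v $ 1 + x $ 2 * v $ 2 + x $ 3 * v $ 3 < v $ 3"
    using g by (auto simp: gx plane_faces_def real_vec_inner)
  moreover have "coords x \<noteq> (0, 0, 0)"
    using nz by (auto simp: gx coords_def vec_eq_iff forall_3)
  moreover have "0 < v $ 1" "v $ 1 \<le> v $ 2" "v $ 2 < v $ 3"
    using v by (auto simp: brun_pos_def)
  ultimately show ?thesis
    using cases by (elim disjE; simp add: gx coords_def)
qed

lemma face_rank_parent_face:
  assumes v: "brun_pos v" and g: "g \<in> plane_faces v"
    and small: "\<And>a. \<bar>fst g $ a\<bar> \<le> 1" and nz: "fst g \<noteq> 0" "fst (parent_face v g) \<noteq> 0"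
  defines "x \<equiv> fst g" and "x' \<equiv> fst (parent_face v g)" and "b \<equiv> brun_branch v"
  shows "face_rank x' \<le> face_rank x \<and> (b = 3 \<and> face_rank x \<noteq> 3 \<longrightarrow> face_rank x' < face_rank x) \<and>
    (face_rank x = 3 \<and> face_rank x' = 3 \<longrightarrow> (core_vertex x', b, core_vertex x) \<in> brun_graph)"
proof -
  obtain i where gx: "g = (x, i)" by (metis x_def prod.collapse)
  obtain c1 c2 c3 where c: "coords x = (c1, c2, c3)" by (metis prod.collapse)
  \<comment> \<open>\<open>h\<close> is the height of the face and \<open>m\<close> the only
    coordinate of the parent that is not copied.\<close>
  define h where "h = c1 * v $ 1 + c2 * v $ 2 + c3 * v $ 3"
  define m where "m = c2 + c3 - of_bool (v $ 2 \<le> h)"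
  have h_eq: "real_vec x \<bullet> v = h"
    using c by (simp add: h_def real_vec_inner coords_def)
  have x': "coords x' = (if b = 1 then (c1, m, c3) else if b = 2 then (c1, c3, m) else (c3, c1, m))"
    using c h_eq
    by (auto simp: coords_def x'_def parent_face_def gx b_def parent_at_def Let_def m_def)
  have "coords x' \<noteq> (0, 0, 0)"
    using nz(2) by (auto simp: coords_def x'_def vec_eq_iff forall_3)
  moreover have v_pos: "0 < v $ 1" "v $ 1 \<le> v $ 2" "v $ 2 < v $ 3"
    using v by (auto simp: brun_pos_def)
  moreover have "0 \<le> h" "h < v $ 3"
    using g exhaust_3[of i] v_pos h_eq by (auto simp: gx plane_faces_def)
  moreover from this have "m = c2 + c3 \<and> h < v $ 2 \<or> m = c2 + c3 - 1 \<and> v $ 2 \<le> h"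
    by (auto simp: m_def)
  moreover have "b = 1 \<and> v $ 2 \<le> v $ 3 - v $ 2 \<or>
      b = 2 \<and> v $ 1 \<le> v $ 3 - v $ 2 \<and> v $ 3 - v $ 2 < v $ 2 \<or> b = 3 \<and> v $ 3 - v $ 2 < v $ 1"
    using v by (auto simp: b_def brun_branch_def brun_pos_def)
  moreover have "(c1, c2, c3) \<in> {(-1, -1, 1), (-1, 0, 1), (-1, 1, 0), (0, -1, 1), (0, 1, -1),
      (0, 1, 0), (1, -1, 0), (1, -1, 1), (1, 0, -1), (1, 0, 0), (1, 1, -1), (1, 1, 0)}"
    using small_plane_face[OF v g small nz(1)] by (simp add: x_def flip: c)
  ultimately show ?thesis
    unfolding x' insert_iff empty_iff simp_thms prod.inject
    \<comment> \<open>Each choice of base point, label and flag either contradicts the linear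
      inequalities or gives an explicit \<open>x'\<close>.\<close>
    by (elim disjE conjE; simp add: c x' h_def face_rank_def core_vertex_def brun_graph_def)
qed

section \<open>Neighbouring faces closer to the origin\<close>

definition norm1 :: "int^3 \<Rightarrow> int" where
  "norm1 x = (\<Sum>a\<in>UNIV. \<bar>x $ a\<bar>)"

lemma real_vec_add_axis: "real_vec (x + axis a c) \<bullet> v = real_vec x \<bullet> v + c * v $ a"
  using exhaust_3[of a] by (auto simp: real_vec_inner axis_def algebra_simps)

lemma norm1_inc: "x $ a < 0 \<Longrightarrow> norm1 (x + axis a 1) = norm1 x - 1"
  using exhaust_3[of a] by (auto simp: norm1_def sum_3 axis_def)

lemma norm1_dec: "0 < x $ a \<Longrightarrow> norm1 (x + axis a (-1)) = norm1 x - 1"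
  using exhaust_3[of a] by (auto simp: norm1_def sum_3 axis_def)

text \<open>Type 3 has the widest window of heights. A unit step towards 0 in one coordinate stays
  in it, unless a negative coordinate cannot be raised and a positive one cannot be lowered; then
  both moves together stay in it.\<close>

lemma plane_face_closer:
  assumes v: "brun_pos v" and g: "(x, i) \<in> plane_faces v" and nz: "x \<noteq> 0"
  obtains x' where "(x', 3) \<in> plane_faces v" "\<And>a. \<bar>x $ a - x' $ a\<bar> \<le> 1" "norm1 x' < norm1 x"
proof -
  define h where "h = real_vec x \<bullet> v"
  have v_pos: "0 < v $ a" and v_le: "v $ a \<le> v $ 3" for a
    using v exhaust_3[of a] by (auto simp: brun_pos_def)
  have h: "0 \<le> h" "h < v $ 3"
    using g v_le[of i] by (auto simp: plane_faces_def h_def)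
  have h_sum: "h = (\<Sum>a\<in>UNIV. x $ a * v $ a)"
    by (simp add: h_def real_vec_inner sum_3)
  \<comment> \<open>The name \<open>that\<close> is rebound by the \<open>if\<close> clause
    below.\<close>
  note result = that
  have dec: thesis if b: "0 < x $ b" "v $ b \<le> h" for b
  proof (rule result[of "x + axis b (-1)"])
    show "(x + axis b (-1), 3) \<in> plane_faces v"
      using b h v_pos[of b] by (simp add: plane_faces_def real_vec_add_axis flip: h_def)
    show "\<bar>x $ a - (x + axis b (-1)) $ a\<bar> \<le> 1" for a
      by (simp add: axis_def)
    show "norm1 (x + axis b (-1)) < norm1 x"
      using b(1) by (simp add: norm1_dec)
  qed
  show thesis
  proof (cases "\<exists>a. x $ a < 0")
    case True
    then obtain a where a: "x $ a < 0" by blast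
    show thesis
    proof (cases "h + v $ a < v $ 3")
      case True
      show thesis
      proof (rule result[of "x + axis a 1"])
        show "(x + axis a 1, 3) \<in> plane_faces v"
          using True h v_pos[of a] by (simp add: plane_faces_def real_vec_add_axis flip: h_def)
        show "\<bar>x $ c - (x + axis a 1) $ c\<bar> \<le> 1" for c
          by (simp add: axis_def)
        show "norm1 (x + axis a 1) < norm1 x"
          using a by (simp add: norm1_inc)
      qed
    next
      case False
      \<comment> \<open>With a negative and no positive coordinate the height would be
        negative.\<close>
      have "\<exists>b. 0 < x $ b"
      proof (rule ccontr)
        assume "\<nexists>b. 0 < x $ b"
        then have "x $ b * v $ b \<le> 0" for b
          using v_pos[of b] by (simp add: mult_le_0_iff not_less)
        moreover have "x $ a * v $ a < 0"
          using a v_pos[of a] by (simp add: mult_less_0_iff)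
        ultimately have "(\<Sum>b\<in>UNIV. x $ b * v $ b) < (\<Sum>b\<in>(UNIV :: 3 set). 0 :: real)"
          by (intro sum_strict_mono_ex1) auto
        then show False using h(1) h_sum by simp
      qed
      then obtain b where b: "0 < x $ b" by blast
      show thesis
      proof (cases "v $ b \<le> h")
        case True
        then show thesis using dec[of b] b by simp
      next
        case no_dec: False
        have ab: "a \<noteq> b" using a b by auto
        show thesis
        proof (rule result[of "x + axis a 1 + axis b (-1)"])
          show "(x + axis a 1 + axis b (-1), 3) \<in> plane_faces v"
            using False no_dec h v_le[of a] v_le[of b]
            by (simp add: plane_faces_def real_vec_add_axis flip: h_def)
          show "\<bar>x $ c - (x + axis a 1 + axis b (-1)) $ c\<bar> \<le> 1" for c
            using ab by (simp add: axis_def)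
          show "norm1 (x + axis a 1 + axis b (-1)) < norm1 x"
          proof -
            have "0 < (x + axis a 1) $ b" using b ab by (simp add: axis_def)
            then show ?thesis using a by (simp add: norm1_inc norm1_dec)
          qed
        qed
      qed
    qed
  next
    case False
    then have nonneg: "0 \<le> x $ a" for a by (simp add: not_less)
    obtain b where "x $ b \<noteq> 0" using nz by (auto simp: vec_eq_iff)
    then have b: "1 \<le> x $ b" using nonneg[of b] by simp
    then have "v $ b \<le> x $ b * v $ b"
      using v_pos[of b] by simp
    also have "\<dots> \<le> h"
      unfolding h_sum using nonneg v_pos by (intro member_le_sum) (simp_all add: less_imp_le)
    finally show thesis using dec[of b] b by simp
  qed
qed

section \<open>Lineages along a Brun expansion\<close>

primrec dual_iter :: "(nat \<Rightarrow> 3) \<Rightarrow> nat \<Rightarrow> face_index set \<Rightarrow> face_index set" where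
  "dual_iter i 0 F = F"
| "dual_iter i (Suc n) F = dual_iter i n (dual_faces (i (Suc n)) F)"

lemma brun_dual_prod_faces_union:
  "brun_dual_prod i n (faces_union F) = faces_union (dual_iter i n F)"
  by (induction n arbitrary: F) (simp_all add: brun_dual_faces_union)

lemma dual_faces_mono: "F \<subseteq> G \<Longrightarrow> dual_faces b F \<subseteq> dual_faces b G"
  by (auto simp: dual_faces_def)

lemma dual_iter_mono: "F \<subseteq> G \<Longrightarrow> dual_iter i n F \<subseteq> dual_iter i n G"
  by (induction n arbitrary: F G) (simp_all add: dual_faces_mono)

text \<open>For a fixed type and flag, \<open>parent_at\<close> is injective, so a face has finitely
  many children.\<close>

lemma finite_dual_faces:
  assumes "finite F"
  shows "finite (dual_faces b F)"
proof -
  have "inj_on (parent_at b hi) (UNIV \<times> {j})" for hi j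
    by (rule inj_onI)
      (auto simp: parent_at_def Let_def vec_eq_iff forall_3 split: if_splits)
  then have "finite (parent_at b hi -` F \<inter> (UNIV \<times> {j}))" for hi j
    by (rule finite_vimage_IntI[OF assms])
  then have "finite (\<Union>hi. \<Union>j. parent_at b hi -` F \<inter> (UNIV \<times> {j}))"
    by (intro finite_UN_I) auto
  moreover have "dual_faces b F \<subseteq> (\<Union>hi. \<Union>j. parent_at b hi -` F \<inter> (UNIV \<times> {j}))"
    by (auto simp: dual_faces_def parent_iff)
  ultimately show ?thesis
    by (rule finite_subset[rotated])
qed

lemma finite_dual_iter: "finite F \<Longrightarrow> finite (dual_iter i n F)"
  by (induction n arbitrary: F) (simp_all add: finite_dual_faces)

text \<open>The parent with empty suffix keeps the base point 0.\<close>

lemma unit_faces_subset_dual_faces: "unit_faces \<subseteq> dual_faces b unit_faces"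
proof
  fix g assume "g \<in> unit_faces"
  then have "parent_at b False g \<in> unit_faces"
    by (auto simp: unit_faces_def parent_at_def Let_def vec_eq_iff forall_3)
  then show "g \<in> dual_faces b unit_faces"
    by (auto simp: dual_faces_def parent_iff)
qed

lemma incseq_dual_iter_unit_faces: "incseq (\<lambda>n. dual_iter i n unit_faces)"
  by (rule incseq_SucI) (simp add: dual_iter_mono unit_faces_subset_dual_faces)

lemma brun_pattern_eq: "brun_pattern i n = faces_union (dual_iter i n unit_faces)"
  by (simp add: brun_pattern_def unit_pattern_eq brun_dual_prod_faces_union)

text \<open>Every letter occurs in the image of some letter, and the incidence matrix is invertible
  over the integers.\<close>

lemma parent_exists: "\<exists>g. parent b g f"
proof -
  obtain B where B: "incidence_matrix (brun_subst b) ** B = mat 1"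
    using incidence_matrix_brun_subst_inverse by blast
  obtain j where "snd f \<in> set (brun_subst b j)"
  proof -
    have "\<exists>j\<in>{1, 2, 3}. snd f \<in> set (brun_subst b j)"
      using exhaust_3[of "snd f"] by (auto simp: brun_subst_def)
    then show ?thesis using that by blast
  qed
  then obtain p s where "brun_subst b j = p @ [snd f] @ s"
    by (metis append_Cons append_Nil split_list)
  then have "parent b (B *v (fst f + abelianization s), j) f"
    by (auto simp: parent_def matrix_vector_mul_assoc B)
  then show ?thesis ..
qed

lemma dual_iter_nonempty: "F \<noteq> {} \<Longrightarrow> dual_iter i n F \<noteq> {}"
proof (induction n arbitrary: F)
  case (Suc n)
  then have "dual_faces (i (Suc n)) F \<noteq> {}"
    using parent_exists by (fastforce simp: dual_faces_def)
  then show ?case using Suc.IH by simp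
qed simp

text \<open>Vectors are indexed from 0 and labels from 1: \<open>i (Suc n)\<close> leads from
  \<open>V n\<close> to \<open>V (Suc n)\<close>.\<close>

locale brun_sequence =
  fixes V :: "nat \<Rightarrow> real^3" and i :: "nat \<Rightarrow> 3"
  assumes pos: "brun_pos (V n)"
    and branch: "i (Suc n) = brun_branch (V n)"
    and step: "V (Suc n) = brun_map (V n)"
    and admissible: "brun_admissible i"
begin

lemma infinitely_many_3: "\<exists>n\<ge>m. i (Suc n) = 3"
proof -
  obtain n where "n > m" "i n = 3"
    using admissible unfolding brun_admissible_def infinite_nat_iff_unbounded by auto
  then show ?thesis by (intro exI[of _ "n - 1"]) auto
qed

primrec lineage :: "face_index \<Rightarrow> nat \<Rightarrow> face_index" where
  "lineage g 0 = g"
| "lineage g (Suc n) = parent_face (V n) (lineage g n)"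

lemma parent_iff_parent_face:
  assumes "g \<in> plane_faces (V n)"
  shows "parent (i (Suc n)) g f \<and> f \<in> plane_faces (V (Suc n)) \<longleftrightarrow> f = parent_face (V n) g"
  using parent_face_iff[OF pos assms] by (simp add: branch step)

lemma lineage_in_plane: "g \<in> plane_faces (V 0) \<Longrightarrow> lineage g n \<in> plane_faces (V n)"
proof (induction n)
  case (Suc n)
  then show ?case
    using parent_iff_parent_face[of "lineage g n" n "lineage g (Suc n)"] by simp
qed simp

lemma dual_faces_subset_plane:
  "F \<subseteq> plane_faces (V (Suc n)) \<Longrightarrow> dual_faces (i (Suc n)) F \<subseteq> plane_faces (V n)"
  using parent_in_plane[OF pos] by (auto simp: dual_faces_def branch step subset_iff)

lemma dual_iter_subset_plane: "F \<subseteq> plane_faces (V n) \<Longrightarrow> dual_iter i n F \<subseteq> plane_faces (V 0)"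
  by (induction n arbitrary: F) (simp_all add: dual_faces_subset_plane)

text \<open>By uniqueness of parents inside the planes. The set \<open>F\<close> varies in the
  induction because \<open>dual_iter\<close> applies the last label first.\<close>

lemma mem_dual_iter_iff:
  assumes "g \<in> plane_faces (V 0)"
  shows "F \<subseteq> plane_faces (V n) \<Longrightarrow> g \<in> dual_iter i n F \<longleftrightarrow> lineage g n \<in> F"
proof (induction n arbitrary: F)
  case (Suc n)
  have "g \<in> dual_iter i (Suc n) F \<longleftrightarrow> (\<exists>f\<in>F. parent (i (Suc n)) (lineage g n) f)"
    using Suc.IH[OF dual_faces_subset_plane[OF Suc.prems]] by (simp add: dual_faces_def)
  also have "\<dots> \<longleftrightarrow> lineage g (Suc n) \<in> F"
    using parent_iff_parent_face[OF lineage_in_plane[OF assms, of n]] Suc.prems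
    by (metis lineage.simps(2) subsetD)
  finally show ?case .
qed simp

lemma unit_faces_subset_plane: "unit_faces \<subseteq> plane_faces (V n)"
proof -
  have "0 < V n $ a" for a
    using pos[of n] exhaust_3[of a] by (auto simp: brun_pos_def)
  then show ?thesis by (auto simp: unit_faces_def plane_faces_def real_vec_inner)
qed

lemma lineage_unit_faces_iff:
  "g \<in> plane_faces (V 0) \<Longrightarrow> lineage g n \<in> unit_faces \<longleftrightarrow> g \<in> dual_iter i n unit_faces"
  by (simp add: mem_dual_iter_iff unit_faces_subset_plane)

lemma lineage_close:
  assumes "g \<in> plane_faces (V 0)" "g' \<in> plane_faces (V 0)" "\<And>a. \<bar>fst g $ a - fst g' $ a\<bar> \<le> 1"
  shows "\<bar>fst (lineage g n) $ a - fst (lineage g' n) $ a\<bar> \<le> 1"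
proof (induction n arbitrary: a)
  case (Suc n)
  show ?case
    using parent_face_close[OF pos lineage_in_plane[OF assms(1)] lineage_in_plane[OF assms(2)] Suc.IH]
    by simp
qed (simp add: assms)

text \<open>The rank is finally constant, and since label 3 still occurs, the constant must be
  3.\<close>

lemma backward_path_of_small_lineage:
  assumes g: "g \<in> plane_faces (V 0)"
    and small: "\<And>n a. n \<ge> N \<Longrightarrow> \<bar>fst (lineage g n) $ a\<bar> \<le> 1"
    and nz: "\<And>n. fst (lineage g n) \<noteq> 0"
  shows "\<exists>k\<ge>1. backward_path_labelling i k"
proof -
  define x where "x n = fst (lineage g n)" for n
  have trans: "face_rank (x (Suc n)) \<le> face_rank (x n)"
      "i (Suc n) = 3 \<Longrightarrow> face_rank (x n) \<noteq> 3 \<Longrightarrow> face_rank (x (Suc n)) < face_rank (x n)"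
      "face_rank (x n) = 3 \<Longrightarrow> face_rank (x (Suc n)) = 3 \<Longrightarrow>
        (core_vertex (x (Suc n)), i (Suc n), core_vertex (x n)) \<in> brun_graph" if "n \<ge> N" for n
    using face_rank_parent_face[OF pos lineage_in_plane[OF g] small[OF that]] nz[of n] nz[of "Suc n"]
    by (simp_all add: x_def branch)
  obtain K where K: "K \<ge> N" "\<And>n. n \<ge> N \<Longrightarrow> face_rank (x K) \<le> face_rank (x n)"
    using ex_has_least_nat[of "\<lambda>n. n \<ge> N" N "\<lambda>n. face_rank (x n)"] by auto
  have const: "face_rank (x n) = face_rank (x K)" if "n \<ge> K" for n
    using that
  proof (induction n rule: dec_induct)
    case (step n)
    then show ?case using trans(1)[of n] K(1) K(2)[of "Suc n"] by simp
  qed simp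
  obtain n where n: "n \<ge> K" "i (Suc n) = 3" using infinitely_many_3 by blast
  have "face_rank (x K) = 3"
    using trans(2)[of n] n const[of n] const[of "Suc n"] K(1) by auto
  then have "(core_vertex (x (Suc n)), i (Suc n), core_vertex (x n)) \<in> brun_graph" if "n \<ge> K" for n
    using trans(3)[of n] const[of n] const[of "Suc n"] that K(1) by auto
  \<comment> \<open>The vertex \<open>w n\<close> comes from \<open>x (n - 1)\<close>, as
    \<open>i n\<close> is the label used at \<open>V (n - 1)\<close>.\<close>
  then have "\<forall>n\<ge>Suc K. (core_vertex (x (n + 1 - 1)), i n, core_vertex (x (n - 1))) \<in> brun_graph"
    by (metis Suc_le_D Suc_le_mono add_diff_cancel_right' diff_Suc_1)
  then have "backward_path_labelling i (Suc K)"
    unfolding backward_path_labelling_def by (intro exI[of _ "\<lambda>n. core_vertex (x (n - 1))"])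
  then show ?thesis by auto
qed

text \<open>A stray face of minimal 1-norm has a neighbour that is absorbed, and its lineage stays
  within distance 1 of the neighbour's.\<close>

lemma backward_path_if_stray:
  assumes "g0 \<in> plane_faces (V 0)" "\<And>n. g0 \<notin> dual_iter i n unit_faces"
  shows "\<exists>k\<ge>1. backward_path_labelling i k"
proof -
  define stray where "stray g \<longleftrightarrow> g \<in> plane_faces (V 0) \<and> (\<forall>n. lineage g n \<notin> unit_faces)" for g
  have "stray g0" using assms by (simp add: stray_def lineage_unit_faces_iff)
  then obtain g where g: "stray g" and min: "\<And>g'. stray g' \<Longrightarrow> nat (norm1 (fst g)) \<le> nat (norm1 (fst g'))"
    using ex_has_least_nat[of stray g0 "\<lambda>g. nat (norm1 (fst g))"] by blast
  have nz: "fst (lineage g n) \<noteq> 0" for n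
    using g by (metis SigmaI UNIV_I prod.collapse singletonI stray_def unit_faces_def)
  have g_in: "(fst g, snd g) \<in> plane_faces (V 0)" using g by (simp add: stray_def)
  from plane_face_closer[OF pos g_in] nz[of 0]
  obtain x' where x': "(x', 3) \<in> plane_faces (V 0)" "\<And>a. \<bar>fst g $ a - x' $ a\<bar> \<le> 1" "norm1 x' < norm1 (fst g)"
    by auto
  have "0 \<le> norm1 x'" by (simp add: norm1_def sum_nonneg)
  then have "\<not> stray (x', 3)" using min[of "(x', 3)"] x'(3) by auto
  then obtain N where "lineage (x', 3) N \<in> unit_faces" using x'(1) by (auto simp: stray_def)
  \<comment> \<open>Once absorbed, a face remains absorbed because the patterns increase.\<close>
  then have "lineage (x', 3) n \<in> unit_faces" if "n \<ge> N" for n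
    using incseqD[OF incseq_dual_iter_unit_faces[of i] that]
    by (auto simp: lineage_unit_faces_iff[OF x'(1)])
  then have zero: "fst (lineage (x', 3) n) = 0" if "n \<ge> N" for n
    using that by (fastforce simp: unit_faces_def)
  show ?thesis
  proof (rule backward_path_of_small_lineage[OF _ _ nz])
    show "g \<in> plane_faces (V 0)" using g_in by simp
    show "\<bar>fst (lineage g n) $ a\<bar> \<le> 1" if "n \<ge> N" for n a
      using lineage_close[of g "(x', 3)" n a] g_in x' zero[OF that] by simp
  qed
qed

end

section \<open>Lifting backward paths to sequences of faces\<close>

definition core_face :: "brun_vertex \<Rightarrow> face_index \<Rightarrow> bool" where
  "core_face w f \<longleftrightarrow> (case w of
      Vp \<Rightarrow> f = (vector [-1, 0, 1], 3)
    | Vq \<Rightarrow> f \<in> {vector [-1, 1, 0]} \<times> {2, 3}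
    | Vr \<Rightarrow> f \<in> {vector [1, 1, -1]} \<times> {1, 2}
    | Vs \<Rightarrow> f = (vector [1, -1, 1], 3))"

text \<open>Checked edge by edge. Two types are allowed at \<open>Vq\<close> and \<open>Vr\<close>
  because both arise as types of parents along edges from these vertices.\<close>

lemma core_face_step:
  assumes "(w', b, w) \<in> brun_graph" "core_face w f"
  obtains f' where "core_face w' f'" "parent b f f'"
proof -
  have "core_face w' (parent_at b False f) \<or> snd f = 3 \<and> core_face w' (parent_at b True f)"
    using assms by (auto simp: brun_graph_def core_face_def parent_at_def Let_def)
  then show thesis using that parent_iff by metis
qed

lemma core_face_exists: "\<exists>f. core_face w f"
  by (cases w) (auto simp: core_face_def)

lemma core_face_not_unit: "core_face w f \<Longrightarrow> f \<notin> unit_faces"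
  by (cases w) (auto simp: core_face_def unit_faces_def vec_eq_iff forall_3)

text \<open>The heights are \<open>v $ 3 - v $ 1\<close> over \<open>Vp\<close> and
  \<open>v $ 2 - v $ 1\<close> over \<open>Vq\<close>; over \<open>Vr\<close> and \<open>Vs\<close>,
  membership depends on \<open>v\<close>.\<close>

lemma core_face_in_plane:
  assumes "brun_pos v" "w \<in> {Vp, Vq}" "core_face w f"
  shows "f \<in> plane_faces v"
  using assms by (auto simp: core_face_def plane_faces_def real_vec_inner brun_pos_def)

context brun_sequence begin

lemma stray_if_backward_path:
  assumes "k \<ge> 1" "backward_path_labelling i k"
  obtains g where "g \<in> plane_faces (V 0)" "\<And>n. g \<notin> dual_iter i n unit_faces"
proof -
  obtain K where K: "k = Suc K" using assms(1) by (cases k) auto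
  obtain w where w: "\<And>n. n \<ge> K \<Longrightarrow> (w (Suc (Suc n)), i (Suc n), w (Suc n)) \<in> brun_graph"
    using assms(2) unfolding backward_path_labelling_def K by force
  obtain f where f: "\<And>m. core_face (w (Suc (K + m))) (f m)"
      "\<And>m. parent (i (Suc (K + m))) (f m) (f (Suc m))"
  proof -
    have "\<exists>f. \<forall>m. core_face (w (Suc (K + m))) (f m) \<and> parent (i (Suc (K + m))) (f m) (f (Suc m))"
    proof (rule dependent_nat_choice)
      show "\<exists>f. core_face (w (Suc (K + 0))) f" by (rule core_face_exists)
      show "\<exists>f'. core_face (w (Suc (K + Suc m))) f' \<and> parent (i (Suc (K + m))) f f'"
        if "core_face (w (Suc (K + m))) f" for f m
        using core_face_step[OF w[of "K + m"] that] by (metis add_Suc_right le_add1)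
    qed
    then show thesis using that by blast
  qed
  \<comment> \<open>Membership in the planes passes from parents to children, so it suffices to know
    it arbitrarily late.\<close>
  have pull: "f m \<in> plane_faces (V (K + m))" if "f (m + l) \<in> plane_faces (V (K + (m + l)))" for m l
    using that
  proof (induction l arbitrary: m)
    case (Suc l)
    then have "f (Suc m) \<in> plane_faces (V (Suc (K + m)))"
      using Suc.IH[of "Suc m"] by simp
    then show ?case
      using parent_in_plane[OF pos[of "K + m"], of "f m" "f (Suc m)"] f(2)[of m]
      by (simp add: branch step)
  qed simp
  \<comment> \<open>An edge labelled 3 ends at \<open>Vp\<close>, or starts at \<open>Vq\<close>, or
    leads from \<open>Vr\<close> to \<open>Vs\<close>; in the last case the following edge of the
    path starts at \<open>Vq\<close>, the only predecessor of \<open>Vr\<close>.\<close>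
  have "\<exists>n\<ge>m. w (Suc (K + n)) \<in> {Vp, Vq}" for m
  proof -
    obtain n where "n \<ge> K + m" "i (Suc n) = 3" using infinitely_many_3 by blast
    then obtain l where l: "l \<ge> m" "i (Suc (K + l)) = 3"
      using that[of "n - K"] by simp
    have "w (Suc (K + l)) \<in> {Vp, Vq} \<or> w (Suc (K + Suc l)) \<in> {Vp, Vq} \<or>
        w (Suc (K + Suc (Suc l))) \<in> {Vp, Vq}"
      using w[of "K + l"] w[of "Suc (K + l)"] l(2) by (auto simp: brun_graph_def)
    then show ?thesis using l(1) le_SucI by blast
  qed
  then have f_in: "f m \<in> plane_faces (V (K + m))" for m
    using pull core_face_in_plane[OF pos] f(1) by (metis le_Suc_ex)
  \<comment> \<open>A descendant \<open>g\<close> of \<open>f 0\<close> in the initial plane, with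
    \<open>f 0\<close> as its \<open>K\<close>-th ancestor.\<close>
  obtain g where g: "g \<in> dual_iter i K {f 0}"
    using dual_iter_nonempty[of "{f 0}" i K] by auto
  have sub: "{f 0} \<subseteq> plane_faces (V K)" using f_in[of 0] by simp
  have g_in: "g \<in> plane_faces (V 0)"
    using dual_iter_subset_plane[OF sub] g by blast
  have lineage: "lineage g (K + m) = f m" for m
  proof (induction m)
    case 0
    then show ?case using g mem_dual_iter_iff[OF g_in sub] by simp
  next
    case (Suc m)
    then show ?case
      using parent_iff_parent_face[OF f_in[of m], of "f (Suc m)"] f(2)[of m] f_in[of "Suc m"] by simp
  qed
  have "g \<notin> dual_iter i n unit_faces" for n
  proof
    assume "g \<in> dual_iter i n unit_faces"
    then have "g \<in> dual_iter i (K + n) unit_faces"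
      using incseqD[OF incseq_dual_iter_unit_faces[of i], of n "K + n"] by auto
    then show False
      using lineage_unit_faces_iff[OF g_in, of "K + n"] lineage core_face_not_unit[OF f(1)] by simp
  qed
  then show thesis using that g_in by blast
qed

end

section \<open>Positivity along the expansion and conclusion\<close>

lemma brun_ordered_map: "brun_ordered v \<Longrightarrow> brun_ordered (brun_map v)"
  by (auto simp: brun_ordered_def brun_map_def brun_branch_def)

lemma brun_map_zero:
  assumes "brun_ordered v" "v $ 1 = 0"
  shows "brun_branch v \<noteq> 3" "brun_map v $ 1 = 0"
  using assms by (auto simp: brun_ordered_def brun_map_def brun_branch_def)

lemma brun_sequence_brun_map:
  assumes adm: "brun_admissible i" and v: "has_brun_expansion v i"
  shows "brun_sequence (\<lambda>n. (brun_map ^^ n) v) i"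
proof -
  define V where "V n = (brun_map ^^ n) v" for n
  have step: "V (Suc n) = brun_map (V n)" for n by (simp add: V_def)
  have ord: "brun_ordered (V n)" for n
    using v by (induction n) (auto simp: V_def has_brun_expansion_def brun_ordered_map)
  have branch: "i (Suc n) = brun_branch (V n)" for n
    using v by (auto simp: has_brun_expansion_def V_def)
  \<comment> \<open>A first coordinate 0 would persist and exclude label 3 from then on.\<close>
  have pos1: "0 < V n $ 1" for n
  proof (rule ccontr)
    assume "\<not> 0 < V n $ 1"
    then have zero: "V n $ 1 = 0" using ord[of n] by (simp add: brun_ordered_def)
    have "V m $ 1 = 0" if "m \<ge> n" for m
      using that by (induction m rule: dec_induct) (auto simp: zero step ord brun_map_zero)
    then have no3: "i (Suc m) \<noteq> 3" if "m \<ge> n" for m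
      using brun_map_zero(1)[OF ord] that by (simp add: branch)
    have "{n. n \<ge> 1 \<and> i n = 3} \<subseteq> {..n}"
    proof
      fix m assume "m \<in> {n. n \<ge> 1 \<and> i n = 3}"
      then show "m \<in> {..n}" using no3[of "m - 1"] by (cases m) force+
    qed
    then show False using adm finite_subset unfolding brun_admissible_def by blast
  qed
  \<comment> \<open>If the last two coordinates were equal, branch 3 would make the next first
    coordinate 0, against \<open>pos1\<close> at \<open>Suc n\<close>.\<close>
  have "brun_pos (V n)" for n
    using ord[of n] pos1[of n] pos1[of "Suc n"]
    by (auto simp: brun_pos_def brun_ordered_def step brun_map_def brun_branch_def split: if_splits)
  then show ?thesis
    using branch step adm unfolding V_def by unfold_locales auto
qed

theorem theorem5p2:
  fixes i :: "nat \<Rightarrow> 3"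
  assumes "brun_admissible i"
  shows "(\<forall>n. pattern (brun_pattern i n)) \<and>
    incseq (brun_pattern i) \<and>
    (\<forall>v :: real^3. (\<forall>a. 0 < v $ a) \<and> has_brun_expansion v i \<longrightarrow>
       (\<forall>n. brun_pattern i n \<subseteq> discrete_plane v) \<and>
       ((\<Union>n. brun_pattern i n) \<subset> discrete_plane v \<longleftrightarrow>
          (\<exists>k\<ge>1. backward_path_labelling i k)))"
proof (intro conjI allI impI)
  show "pattern (brun_pattern i n)" for n
    unfolding pattern_def brun_pattern_eq faces_union_def
    by (intro exI[of _ "dual_iter i n unit_faces"]) (simp add: finite_dual_iter unit_faces_def)
  show "incseq (brun_pattern i)"
    using incseq_dual_iter_unit_faces[of i] by (simp add: incseq_def brun_pattern_eq faces_union_subset_iff)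
next
  fix v :: "real^3"
  assume v: "(\<forall>a. 0 < v $ a) \<and> has_brun_expansion v i"
  interpret brun_sequence "\<lambda>n. (brun_map ^^ n) v" i
    using brun_sequence_brun_map assms v by blast
  have sub: "dual_iter i n unit_faces \<subseteq> plane_faces v" for n
    using dual_iter_subset_plane[OF unit_faces_subset_plane, of n] by simp
  then show "brun_pattern i n \<subseteq> discrete_plane v" for n
    by (simp add: brun_pattern_eq discrete_plane_eq faces_union_subset_iff)
  \<comment> \<open>The claim is moved to index sets, where a proper inclusion means that some face
    of the plane is never absorbed.\<close>
  have "(\<Union>n. brun_pattern i n) = faces_union (\<Union>n. dual_iter i n unit_faces)"
    by (auto simp: brun_pattern_eq faces_union_def)
  then have "(\<Union>n. brun_pattern i n) \<subset> discrete_plane v \<longleftrightarrow> (\<Union>n. dual_iter i n unit_faces) \<subset> plane_faces v"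
    by (simp add: discrete_plane_eq less_le_not_le faces_union_subset_iff)
  also have "\<dots> \<longleftrightarrow> \<not> plane_faces v \<subseteq> (\<Union>n. dual_iter i n unit_faces)"
  proof -
    have "(\<Union>n. dual_iter i n unit_faces) \<subseteq> plane_faces v" using sub by blast
    then show ?thesis by (simp add: less_le_not_le)
  qed
  also have "\<dots> \<longleftrightarrow> (\<exists>g\<in>plane_faces v. \<forall>n. g \<notin> dual_iter i n unit_faces)"
    unfolding subset_iff by blast
  also have "\<dots> \<longleftrightarrow> (\<exists>k\<ge>1. backward_path_labelling i k)"
  proof
    assume "\<exists>g\<in>plane_faces v. \<forall>n. g \<notin> dual_iter i n unit_faces"
    then show "\<exists>k\<ge>1. backward_path_labelling i k"
      using backward_path_if_stray by auto
  next
    assume "\<exists>k\<ge>1. backward_path_labelling i k"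
    then obtain k where "k \<ge> 1" "backward_path_labelling i k" by blast
    then show "\<exists>g\<in>plane_faces v. \<forall>n. g \<notin> dual_iter i n unit_faces"
      by (rule stray_if_backward_path) auto
  qed
  finally show "(\<Union>n. brun_pattern i n) \<subset> discrete_plane v \<longleftrightarrow> (\<exists>k\<ge>1. backward_path_labelling i k)" .
qed

end
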